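(* For any convex body $K\in\mathcal{K}^n$ there exists an anti-blocking convex body $A\subseteq\mathbb{R}^n_{\geq 0}$ such that: (i) $\mathrm{vol}(K)=\mathrm{vol}(A)$; (ii) $\mathrm{G}(K)\leq\mathrm{G}(A)$; (iii) $\mathrm{G}(\mathrm{int}\,K)\geq\mathrm{G}(\mathrm{int}\,A)$; and (iv) $\lambda_i(K)\geq\lambda_i(A)$ for all $i\in\{1,\dots,n\}$.
   Context: $\mathcal{K}^n$ is the class of all compact convex sets (convex bodies) in $\mathbb{R}^n$ with non-empty interior. A convex body $A\subseteq\mathbb{R}^n_{\geq0}$ is anti-blocking if for every $x=(x_1,\dots,x_n)\in A$ the set $\{x'\in\mathbb{R}^n_{\geq 0}:x_i'\leq x_i \text{ for all } i\}$ is contained in $A$. For $S\subseteq\mathbb{R}^n$, $\mathrm{G}(S)=|S\cap\mathbb{Z}^n|$ is the number of integer points in $S$; $\mathrm{vol}$ is the $n$-dimensional volume and $\mathrm{int}$ denotes the interior. For $K\in\mathcal{K}^n$ with $K=-K$, the $i$-th successive minimum is $\lambda_i(K)=\min\{\lambda>0:\dim(\lambda K\cap\mathbb{Z}^n)\geq i\}$, $1\le i\le n$, where $\dim$ of a set of lattice points in the symmetric body is the dimension of its linear span. For general $K\in\mathcal{K}^n$ one puts $\lambda_i(K)=\lambda_i(\mathrm{cs}(K))$, where $\mathrm{cs}(K)=\frac12(K-K)$. *)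

theory Defs
  imports "HOL-Analysis.Analysis"
begin

definition convex_body :: "(real ^ 'n) set \<Rightarrow> bool" where
  "convex_body K \<longleftrightarrow> compact K \<and> convex K \<and> interior K \<noteq> {}"

definition anti_blocking :: "(real ^ 'n) set \<Rightarrow> bool" where
  "anti_blocking A \<longleftrightarrow> convex_body A \<and> A \<subseteq> {x. \<forall>i. 0 \<le> x $ i} \<and>
     (\<forall>x\<in>A. {x'. (\<forall>i. 0 \<le> x' $ i) \<and> (\<forall>i. x' $ i \<le> x $ i)} \<subseteq> A)"

definition int_lattice :: "(real ^ 'n) set" where
  "int_lattice = {x. \<forall>i. x $ i \<in> \<int>}"

text \<open>Used for bounded sets only, so the intersection is finite (lemma \<open>finite_lattice_bounded\<close>) and \<open>card\<close> is
  the actual number of points.\<close>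

definition lattice_count :: "(real ^ 'n) set \<Rightarrow> nat" where
  "lattice_count S = card (S \<inter> int_lattice)"

definition cs :: "(real ^ 'n) set \<Rightarrow> (real ^ 'n) set" where
  "cs K = {(1/2) *\<^sub>R (x - y) | x y. x \<in> K \<and> y \<in> K}"

text \<open>Here \<open>dim\<close> is the dimension of the linear span. The minimum exists for
  symmetric convex bodies and \<open>1 \<le> i \<le> n\<close>, see \<open>sym_successive_minimum\<close> below.\<close>

definition sym_successive_min :: "nat \<Rightarrow> (real ^ 'n) set \<Rightarrow> real" where
  "sym_successive_min i K = (LEAST t. t > 0 \<and> dim ((*\<^sub>R) t ` K \<inter> int_lattice) \<ge> i)"

definition successive_min :: "nat \<Rightarrow> (real ^ 'n) set \<Rightarrow> real" where
  "successive_min i K = sym_successive_min i (cs K)"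

lemma finite_lattice_bounded:
  fixes S :: "(real ^ 'n) set"
  assumes "bounded S"
  shows "finite (S \<inter> int_lattice)"
proof -
  obtain B where B: "\<And>x. x \<in> S \<Longrightarrow> norm x \<le> B"
    using assms by (auto simp: bounded_iff)
  have "inj_on vec_nth (S \<inter> int_lattice)"
    by (auto simp: inj_on_def vec_eq_iff)
  moreover have "vec_nth ` (S \<inter> int_lattice) \<subseteq> (PiE UNIV (\<lambda>_. {k. k \<in> \<int> \<and> \<bar>k\<bar> \<le> B}))"
  proof (rule image_subsetI)
    fix x assume x: "x \<in> S \<inter> int_lattice"
    then have "\<bar>x $ j\<bar> \<le> B" for j
      using B[of x] component_le_norm_cart[of x j] by fastforce
    with x show "vec_nth x \<in> PiE UNIV (\<lambda>_. {k. k \<in> \<int> \<and> \<bar>k\<bar> \<le> B})"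
      by (auto simp: int_lattice_def PiE_def extensional_def)
  qed
  moreover have "finite (PiE (UNIV :: 'n set) (\<lambda>_. {k. k \<in> \<int> \<and> \<bar>k\<bar> \<le> B}))"
    by (intro finite_PiE finite_abs_int_segment) auto
  ultimately show ?thesis
    by (rule inj_on_finite)
qed

lemma convex_body_cs:
  assumes "convex_body K"
  shows "convex_body (cs K)" "uminus ` cs K = cs K"
proof -
  have eq: "cs K = (*\<^sub>R) (1/2) ` {x - y | x y. x \<in> K \<and> y \<in> K}"
    by (auto simp: cs_def)
  have "compact (cs K)" unfolding eq
    using assms by (intro compact_scaling compact_differences) (auto simp: convex_body_def)
  moreover have "convex (cs K)" unfolding eq
  proof (rule convex_scaling)
    have "{x - y | x y. x \<in> K \<and> y \<in> K} = (\<Union>x\<in>K. \<Union>y\<in>K. {x - y})" by auto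
    then show "convex {x - y | x y. x \<in> K \<and> y \<in> K}"
      using convex_differences[of K K] assms by (simp only: convex_body_def)
  qed
  moreover have "interior (cs K) \<noteq> {}"
  proof -
    obtain a where a: "a \<in> interior K" using assms by (auto simp: convex_body_def)
    have "(\<lambda>x. (1/2) *\<^sub>R (x - a)) ` K \<subseteq> cs K"
      using a interior_subset by (auto simp: cs_def)
    then have "(\<lambda>x. (1/2) *\<^sub>R (x - a)) ` interior K \<subseteq> cs K"
      using interior_subset[of K] by (meson image_mono subset_trans)
    moreover have "open ((*\<^sub>R) (1/2) ` (\<lambda>x. x - a) ` interior K)"
      by (intro open_scaling open_translation_subtract) auto
    ultimately have "(\<lambda>x. (1/2) *\<^sub>R (x - a)) ` interior K \<subseteq> interior (cs K)"
      by (intro interior_maximal) (simp_all add: image_image)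
    with a show ?thesis by auto
  qed
  ultimately show "convex_body (cs K)" by (simp add: convex_body_def)
  have neg: "- z \<in> cs K" if z: "z \<in> cs K" for z
  proof -
    obtain x y where "x \<in> K" "y \<in> K" "z = (1/2) *\<^sub>R (x - y)" using z by (auto simp: cs_def)
    moreover from this have "- z = (1/2) *\<^sub>R (y - x)" by (simp flip: scaleR_minus_right)
    ultimately show ?thesis unfolding cs_def by blast
  qed
  show "uminus ` cs K = cs K"
  proof
    show "uminus ` cs K \<subseteq> cs K" using neg by blast
    show "cs K \<subseteq> uminus ` cs K"
    proof
      fix z assume "z \<in> cs K"
      then show "z \<in> uminus ` cs K" using neg[of z] by (intro image_eqI[of _ _ "- z"]) auto
    qed
  qed
qed

lemma sym_successive_minimum:
  fixes K :: "(real ^ 'n) set"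
  assumes K: "convex_body K" "uminus ` K = K" and i: "1 \<le> i" "i \<le> CARD('n)"
  defines "P \<equiv> \<lambda>t. t > 0 \<and> dim ((*\<^sub>R) t ` K \<inter> int_lattice) \<ge> i"
  shows "P (sym_successive_min i K)" "\<And>t. P t \<Longrightarrow> sym_successive_min i K \<le> t"
proof -
  have cK: "compact K" "convex K" using K by (auto simp: convex_body_def)
  have bd: "bounded ((*\<^sub>R) t ` K)" for t
    by (simp add: cK compact_imp_bounded compact_scaling)
  have ex: "\<exists>t. P t"
  proof -
    obtain a e where e: "e > 0" "cball a e \<subseteq> K"
      using K by (metis convex_body_def ex_in_conv mem_interior_cball)
    have ball: "v \<in> K" if "norm v \<le> e" for v
    proof -
      have 1: "a + v \<in> K" "a - v \<in> K" using e that by (auto simp: subset_iff dist_norm)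
      then have "- (a - v) \<in> K" using K(2) by blast
      with 1 have "(1/2) *\<^sub>R (a + v) + (1/2) *\<^sub>R (- (a - v)) \<in> K"
        using cK(2) by (intro convexD) auto
      moreover have "(1/2) *\<^sub>R (a + v) + (1/2) *\<^sub>R (- (a - v)) = v"
        by (simp add: algebra_simps flip: scaleR_add_left)
      ultimately show ?thesis by simp
    qed
    have "Basis \<subseteq> (*\<^sub>R) (1/e) ` K \<inter> int_lattice"
    proof
      fix b :: "real ^ 'n" assume b: "b \<in> Basis"
      then have "b = (1/e) *\<^sub>R (e *\<^sub>R b)" "e *\<^sub>R b \<in> K" using e ball by auto
      moreover have "b \<in> int_lattice"
        using b by (auto simp: Basis_vec_def int_lattice_def axis_def)
      ultimately show "b \<in> (*\<^sub>R) (1/e) ` K \<inter> int_lattice" by blast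
    qed
    then have "dim (Basis :: (real ^ 'n) set) \<le> dim ((*\<^sub>R) (1/e) ` K \<inter> int_lattice)"
      by (rule dim_subset)
    moreover have "dim (Basis :: (real ^ 'n) set) = CARD('n)"
      by (metis dim_span dim_UNIV span_Basis DIM_cart DIM_real mult.right_neutral)
    ultimately show ?thesis using e i by (intro exI[of _ "1/e"]) (auto simp: P_def)
  qed
  then obtain t0 where t0: "P t0" by blast
  define F where "F = (*\<^sub>R) t0 ` K \<inter> int_lattice"
  have finF: "finite F" unfolding F_def using bd by (rule finite_lattice_bounded)
  have zero: "0 \<in> K"
  proof -
    obtain a where "a \<in> K" using K by (metis convex_body_def ex_in_conv interior_subset subsetD)
    then have "(1/2) *\<^sub>R a + (1/2) *\<^sub>R (- a) \<in> K"
      using K(2) cK(2) by (intro convexD) auto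
    then show ?thesis by simp
  qed
  have mono: "(*\<^sub>R) s ` K \<subseteq> (*\<^sub>R) t ` K" if "0 < s" "s \<le> t" for s t
  proof
    fix x assume "x \<in> (*\<^sub>R) s ` K"
    then obtain y where y: "y \<in> K" "x = s *\<^sub>R y" by auto
    have "(s/t) *\<^sub>R y + (1 - s/t) *\<^sub>R 0 \<in> K"
      using that y zero cK(2) by (intro convexD) auto
    then have "(s/t) *\<^sub>R y \<in> K" by simp
    moreover have "x = t *\<^sub>R ((s/t) *\<^sub>R y)" using y that by auto
    ultimately show "x \<in> (*\<^sub>R) t ` K" by blast
  qed
  \<comment> \<open>For each finite set of lattice points the admissible dilates form a closed set.\<close>
  define Q where "Q = (\<lambda>T. {t \<in> {0..t0}. \<forall>v\<in>T. v \<in> (*\<^sub>R) t ` K})"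
  have clQ: "compact (Q T)" for T
  proof -
    have "closed {t. v \<in> (*\<^sub>R) t ` K \<and> t \<in> {0..t0}}" for v
    proof -
      have "{t. v \<in> (*\<^sub>R) t ` K \<and> t \<in> {0..t0}}
          = fst ` ({0..t0} \<times> K \<inter> {p. fst p *\<^sub>R snd p = v})" by force
      moreover have "compact ({0..t0} \<times> K \<inter> {p. fst p *\<^sub>R snd p = v})"
        by (intro compact_Int_closed compact_Times closed_Collect_eq continuous_intros cK)
           auto
      ultimately show ?thesis
        by (simp only:) (intro compact_imp_closed compact_continuous_image continuous_on_fst continuous_on_id)
    qed
    then have "closed ({0..t0} \<inter> (\<Inter>v\<in>T. {t. v \<in> (*\<^sub>R) t ` K \<and> t \<in> {0..t0}}))"
      by (intro closed_Int closed_INT) auto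
    moreover have "Q T = {0..t0} \<inter> (\<Inter>v\<in>T. {t. v \<in> (*\<^sub>R) t ` K \<and> t \<in> {0..t0}})"
      by (auto simp: Q_def)
    ultimately have "closed (Q T)" by (simp only:)
    moreover have "Q T \<subseteq> {0..t0}" by (auto simp: Q_def)
    ultimately show ?thesis
      using bounded_subset[OF bounded_closed_interval] compact_eq_bounded_closed by blast
  qed
  define U where "U = (\<Union>T\<in>{T. T \<subseteq> F \<and> i \<le> dim T}. Q T)"
  have "compact U" unfolding U_def using finF clQ by (intro compact_UN) auto
  have UP: "t \<in> U \<longleftrightarrow> P t \<and> t \<le> t0" for t
  proof
    assume "t \<in> U"
    then obtain T where T: "T \<subseteq> F" "i \<le> dim T" "0 \<le> t" "t \<le> t0" "T \<subseteq> (*\<^sub>R) t ` K"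
      by (auto simp: U_def Q_def)
    have "t \<noteq> 0"
    proof
      assume "t = 0"
      with T have "T \<subseteq> {0}" by auto
      then have "dim T \<le> 0" by (simp add: dim_eq_0)
      with T i show False by auto
    qed
    moreover have "dim T \<le> dim ((*\<^sub>R) t ` K \<inter> int_lattice)"
      using T by (intro dim_subset) (auto simp: F_def)
    ultimately show "P t \<and> t \<le> t0" using T by (auto simp: P_def)
  next
    assume t: "P t \<and> t \<le> t0"
    then have "(*\<^sub>R) t ` K \<inter> int_lattice \<subseteq> F" unfolding F_def using mono[of t t0]
      by (auto simp: P_def)
    with t show "t \<in> U" unfolding U_def Q_def
      by (intro UN_I[of "(*\<^sub>R) t ` K \<inter> int_lattice"]) (auto simp: P_def)
  qed
  have "t0 \<in> U" using t0 UP by auto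
  then obtain m where m: "m \<in> U" "\<And>t. t \<in> U \<Longrightarrow> m \<le> t"
    using compact_attains_inf[OF \<open>compact U\<close>] by blast
  have Pm: "P m" and le: "\<And>t. P t \<Longrightarrow> m \<le> t"
    using m UP by (blast, meson linorder_le_cases order_trans)
  have "sym_successive_min i K = m"
    unfolding sym_successive_min_def using Pm le unfolding P_def by (intro Least_equality) auto
  with Pm le show "P (sym_successive_min i K)" "\<And>t. P t \<Longrightarrow> sym_successive_min i K \<le> t" by auto
qed

end

theory Submission
  imports Defs
begin

text \<open>Shaking \<open>K\<close> along a coordinate axis replaces every line segment \<open>K \<inter> (x + \<real> e\<^sub>j)\<close> by the segment
  of the same length that starts on the hyperplane \<open>x\<^sub>j = 0\<close>. This keeps the volume, does not decrease
  the number of lattice points and does not increase the number of interior lattice points, and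
  shaking once along each axis yields an anti-blocking body.

  For the successive minima, shaking in the given coordinates does not suffice: the parallelogram
  with vertices \<open>\<plusminus>(1, 0)\<close>, \<open>\<plusminus>(1, 1)\<close> has both minima equal to \<open>1\<close>, but shaken along \<open>e\<^sub>2\<close> its
  second minimum becomes \<open>2\<close>. So first a unimodular map is applied after which there are vectors
  \<open>w\<^sub>i \<in> cs K\<close> with \<open>\<lambda>\<^sub>i w\<^sub>i\<close> integral, supported on the first \<open>i\<close> coordinates and with nonzero
  \<open>i\<close>-th coordinate. Shaking along \<open>e\<^sub>j\<close> allows one to replace the \<open>j\<close>-th coordinate of a vector of
  \<open>cs K\<close> by \<open>0\<close>, and keeps the multiples of \<open>e\<^sub>j\<close> in \<open>cs K\<close>. Shaking along \<open>e\<^sub>1, \<dots>, e\<^sub>n\<close> in this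
  order therefore reduces each \<open>w\<^sub>i\<close> to a nonzero multiple of \<open>e\<^sub>i\<close>.\<close>

subsection \<open>Fibres in a coordinate direction\<close>

definition put :: "'n \<Rightarrow> real \<Rightarrow> real ^ 'n \<Rightarrow> real ^ 'n" where
  "put j t x = (\<chi> l. if l = j then t else x $ l)"

lemma put_nth [simp]: "put j t x $ l = (if l = j then t else x $ l)"
  by (simp add: put_def)

lemma put_put [simp]: "put j s (put j t x) = put j s x"
  by (simp add: vec_eq_iff)

lemma put_self [simp]: "put j (x $ j) x = x"
  by (simp add: vec_eq_iff)

lemma put_commute: "i \<noteq> j \<Longrightarrow> put i s (put j t x) = put j t (put i s x)"
  by (simp add: vec_eq_iff)

lemma put_eq_add_axis: "put j t x = x + (t - x $ j) *\<^sub>R axis j 1"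
  by (simp add: vec_eq_iff axis_def)

lemma put_of_zero: "x $ j = 0 \<Longrightarrow> put j t x = t *\<^sub>R axis j 1 + x"
  by (simp add: put_eq_add_axis)

lemma put_convex_comb:
  "put j (u * a + v * b) (u *\<^sub>R x + v *\<^sub>R y) = u *\<^sub>R put j a x + v *\<^sub>R put j b y"
  by (simp add: vec_eq_iff)

lemma continuous_on_put [continuous_intros]:
  assumes "continuous_on S f" "continuous_on S g"
  shows "continuous_on S (\<lambda>p. put j (f p) (g p))"
  unfolding put_eq_add_axis by (intro continuous_intros assms)

text \<open>Tonelli, with the coordinate \<open>j\<close> split off the product measure over
  \<open>Basis\<close>. The sum over the remaining basis vectors has \<open>j\<close>-th coordinate
  0, so inserting \<open>t\<close> there parametrises the fibre.\<close>

lemma emeasure_lborel_fibres: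
  fixes S :: "(real ^ 'n) set"
  assumes "S \<in> sets borel"
  shows "emeasure lborel S =
    (\<integral>\<^sup>+ f. emeasure lborel {t. put j t (\<Sum>b\<in>Basis - {axis j 1}. f b *\<^sub>R b) \<in> S}
      \<partial>(\<Pi>\<^sub>M b\<in>Basis - {axis j 1}. lborel))"
proof -
  define B where "B = (Basis :: (real ^ 'n) set) - {axis j 1}"
  have axB: "axis j 1 \<in> (Basis :: (real ^ 'n) set)"
    by (simp add: axis_in_Basis_iff)
  have ins: "(Basis :: (real ^ 'n) set) = insert (axis j 1) B" "axis j 1 \<notin> B" "finite B"
    using axB by (auto simp: B_def)
  interpret product_sigma_finite "\<lambda>_ :: real ^ 'n. lborel :: real measure" ..
  define h where "h = (\<lambda>f :: real ^ 'n \<Rightarrow> real. \<Sum>b\<in>Basis. f b *\<^sub>R b)"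
  have h: "h \<in> measurable (\<Pi>\<^sub>M b\<in>Basis. lborel) borel"
    unfolding h_def by measurable
  have put: "h (f(axis j 1 := t)) = put j t (\<Sum>b\<in>B. f b *\<^sub>R b)" for f t
  proof -
    have "h (f(axis j 1 := t)) = t *\<^sub>R axis j 1 + (\<Sum>b\<in>B. (f(axis j 1 := t)) b *\<^sub>R b)"
      unfolding h_def ins(1) using ins(2,3) by (subst sum.insert) auto
    also have "(\<Sum>b\<in>B. (f(axis j 1 := t)) b *\<^sub>R b) = (\<Sum>b\<in>B. f b *\<^sub>R b)" (is "_ = ?y")
      using ins by (intro sum.cong) auto
    also have "t *\<^sub>R axis j 1 + ?y = put j t ?y"
    proof -
      have "?y $ j = 0"
        unfolding sum_component
      proof (rule sum.neutral, rule ballI)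
        fix b assume "b \<in> B"
        then obtain i where "b = axis i 1" "i \<noteq> j"
          by (auto simp: B_def Basis_vec_def axis_eq_axis)
        then show "(f b *\<^sub>R b) $ j = 0"
          by (simp add: axis_def)
      qed
      then show ?thesis
        by (rule put_of_zero[symmetric])
    qed
    finally show ?thesis .
  qed
  have "emeasure lborel S = (\<integral>\<^sup>+ x. indicator S x \<partial>distr (\<Pi>\<^sub>M b\<in>Basis. lborel) borel h)"
    using assms by (simp add: lborel_eq[where 'a = "real ^ 'n", folded h_def])
  also have "\<dots> = (\<integral>\<^sup>+ f. indicator S (h f) \<partial>(\<Pi>\<^sub>M b\<in>Basis. lborel))"
    using assms h by (subst nn_integral_distr) auto
  also have "\<dots> = (\<integral>\<^sup>+ f. \<integral>\<^sup>+ t. indicator S (h (f(axis j 1 := t))) \<partial>lborel \<partial>(\<Pi>\<^sub>M b\<in>B. lborel))"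
    unfolding ins(1) using assms h ins
    by (subst product_nn_integral_insert) auto
  also have "\<dots> = (\<integral>\<^sup>+ f. emeasure lborel {t. put j t (\<Sum>b\<in>B. f b *\<^sub>R b) \<in> S} \<partial>(\<Pi>\<^sub>M b\<in>B. lborel))"
  proof (intro nn_integral_cong)
    fix f :: "real ^ 'n \<Rightarrow> real"
    let ?y = "\<Sum>b\<in>B. f b *\<^sub>R b"
    have "(\<lambda>t. put j t ?y) \<in> borel_measurable borel"
      by (intro borel_measurable_continuous_onI continuous_intros)
    then have "(\<lambda>t. put j t ?y) -` S \<inter> space borel \<in> sets borel"
      using assms by (rule measurable_sets)
    then have "{t. put j t ?y \<in> S} \<in> sets lborel"
      by (simp add: vimage_def)
    moreover have "(\<lambda>t. indicator S (h (f(axis j 1 := t))) :: ennreal) = indicator {t. put j t ?y \<in> S}"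
      by (auto simp: put indicator_def)
    ultimately show "(\<integral>\<^sup>+ t. indicator S (h (f(axis j 1 := t))) \<partial>lborel) = emeasure lborel {t. put j t ?y \<in> S}"
      by simp
  qed
  finally show ?thesis
    by (simp add: B_def)
qed

lemma emeasure_lborel_translation: "emeasure lborel ((+) (c :: real) ` S) = emeasure lborel S"
proof (cases "S \<in> sets borel")
  case True
  have eq: "(+) c ` S = (+) (- c) -` S"
    by (force simp: image_iff)
  have "emeasure lborel S = emeasure (distr lborel borel ((+) (- c))) S"
    by (simp add: lborel_distr_plus)
  also have "\<dots> = emeasure lborel ((+) c ` S)"
    using True by (subst emeasure_distr) (auto simp: eq)
  finally show ?thesis ..
next
  \<comment> \<open>Outside the Borel sets \<open>emeasure\<close> is 0 by convention, so it
    suffices that a translate of a non-Borel set is not Borel either.\<close>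
  case False
  have "S \<in> sets borel" if "(+) c ` S \<in> sets borel"
  proof -
    have "S = (+) c -` (+) c ` S" by auto
    then show ?thesis
      using measurable_sets[of "(+) c" borel borel "(+) c ` S"] that by auto
  qed
  with False have "(+) c ` S \<notin> sets lborel" "S \<notin> sets lborel"
    by auto
  then show ?thesis
    using emeasure_notin_sets[of S lborel] emeasure_notin_sets[of "(+) c ` S" lborel] by metis
qed

text \<open>Cavalieri's principle; it gives the invariance of volume both for shears, which
  translate every fibre, and for shaking.\<close>

lemma measure_eq_fibres:
  fixes S T :: "(real ^ 'n) set"
  assumes "compact S" "compact T"
    and "\<And>x. emeasure lborel {t. put j t x \<in> S} = emeasure lborel {t. put j t x \<in> T}"
  shows "measure lebesgue S = measure lebesgue T"
proof -
  have "S \<in> sets borel" "T \<in> sets borel"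
    using assms by (auto intro: borel_compact)
  moreover from this have "emeasure lborel S = emeasure lborel T"
    by (simp only: emeasure_lborel_fibres[where j = j] assms(3))
  ultimately show ?thesis
    by (simp add: measure_def)
qed

subsection \<open>Unimodular maps\<close>

text \<open>These are the maps with matrix in GL(n, Z), described by the invariances that the proof
  uses, so that composition is immediate and no determinants occur. Compact sets are the class on
  which \<open>measure_eq_fibres\<close> compares volumes.\<close>

definition unimodular_map :: "(real ^ 'n \<Rightarrow> real ^ 'n) \<Rightarrow> bool" where
  "unimodular_map g \<longleftrightarrow> linear g \<and> bij g \<and> g ` int_lattice = int_lattice \<and>
     (\<forall>S. compact S \<longrightarrow> measure lebesgue (g ` S) = measure lebesgue S)"

lemma compact_linear_image:
  fixes g :: "'a::euclidean_space \<Rightarrow> 'b::real_normed_vector"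
  assumes "linear g" "compact S"
  shows "compact (g ` S)"
proof -
  have "continuous_on S g"
    using assms(1) by (simp add: linear_continuous_on linear_conv_bounded_linear)
  then show ?thesis using assms(2) by (rule compact_continuous_image)
qed

lemma unimodular_map_id: "unimodular_map (\<lambda>x. x)"
  by (simp add: unimodular_map_def linear_id[unfolded id_def] bij_id[unfolded id_def])

lemma unimodular_map_compose:
  fixes f g :: "real ^ 'n \<Rightarrow> real ^ 'n"
  assumes f: "unimodular_map f" and g: "unimodular_map g"
  shows "unimodular_map (f \<circ> g)"
  unfolding unimodular_map_def
proof (intro conjI allI impI)
  show "linear (f \<circ> g)"
    using assms unfolding unimodular_map_def by (blast intro: linear_compose)
  show "bij (f \<circ> g)"
    using assms unfolding unimodular_map_def by (blast intro: bij_comp)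
  show "(f \<circ> g) ` int_lattice = int_lattice"
    using assms by (simp only: unimodular_map_def flip: image_comp)
  fix S :: "(real ^ 'n) set" assume S: "compact S"
  have "linear g" using g by (simp only: unimodular_map_def)
  then have "compact (g ` S)" using S by (rule compact_linear_image)
  then have "measure lebesgue (f ` g ` S) = measure lebesgue (g ` S)"
    using f by (simp only: unimodular_map_def)
  also have "\<dots> = measure lebesgue S"
    using g S by (simp only: unimodular_map_def)
  finally show "measure lebesgue ((f \<circ> g) ` S) = measure lebesgue S"
    by (simp only: image_comp)
qed

lemma unimodular_map_linear: "unimodular_map g \<Longrightarrow> linear g"
  by (simp add: unimodular_map_def)

lemma unimodular_map_inj: "unimodular_map g \<Longrightarrow> inj g"
  by (simp add: unimodular_map_def bij_is_inj)

lemma unimodular_map_lattice: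
  assumes "unimodular_map g" "x \<in> int_lattice"
  shows "g x \<in> int_lattice"
  using assms by (auto simp: unimodular_map_def)

lemma measure_unimodular_image:
  assumes "unimodular_map g" "compact S"
  shows "measure lebesgue (g ` S) = measure lebesgue S"
  using assms unfolding unimodular_map_def by blast

lemma lattice_count_unimodular_image:
  assumes "unimodular_map g"
  shows "lattice_count (g ` S) = lattice_count S"
proof -
  have "inj g" "g ` int_lattice = int_lattice"
    using assms by (auto simp: unimodular_map_def bij_is_inj)
  then have "g ` S \<inter> int_lattice = g ` (S \<inter> int_lattice)"
    by (simp add: image_Int)
  then show ?thesis
    using \<open>inj g\<close> by (simp add: lattice_count_def card_image inj_on_subset)
qed

lemma interior_unimodular_image:
  fixes g :: "real ^ 'n \<Rightarrow> real ^ 'n"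
  assumes "unimodular_map g"
  shows "interior (g ` S) = g ` interior S"
  using assms interior_bijective_linear_image[of g S] by (simp add: unimodular_map_def)

lemma convex_body_unimodular_image:
  assumes "unimodular_map g" "convex_body K"
  shows "convex_body (g ` K)"
  using assms interior_unimodular_image[OF assms(1), of K]
  by (auto simp: convex_body_def unimodular_map_def intro: convex_linear_image
      compact_linear_image)

lemma unimodular_image_cs:
  assumes "unimodular_map g" "x \<in> cs K"
  shows "g x \<in> cs (g ` K)"
proof -
  have "linear g" using assms by (simp add: unimodular_map_def)
  moreover obtain y z where "y \<in> K" "z \<in> K" "x = (1/2) *\<^sub>R (y - z)"
    using assms(2) by (auto simp: cs_def)
  ultimately have "g x = (1/2) *\<^sub>R (g y - g z)"
    by (simp add: linear_scale linear_diff)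
  with \<open>y \<in> K\<close> \<open>z \<in> K\<close> show ?thesis
    by (auto simp: cs_def)
qed

definition shear :: "'n \<Rightarrow> 'n \<Rightarrow> real \<Rightarrow> real ^ 'n \<Rightarrow> real ^ 'n" where
  "shear j k c x = (\<chi> l. if l = j then x $ j + c * x $ k else x $ l)"

lemma shear_nth [simp]: "shear j k c x $ l = (if l = j then x $ j + c * x $ k else x $ l)"
  by (simp add: shear_def)

lemma shear_shear_minus: "j \<noteq> k \<Longrightarrow> shear j k c (shear j k (- c) x) = x"
  by (simp add: vec_eq_iff)

text \<open>The inverse is the shear with \<open>- c\<close>, which gives bijectivity and
  integrality in both directions. As \<open>x $ k\<close> is constant along each line in direction
  \<open>j\<close>, the shear translates every such line, so volume is kept fibrewise.\<close>

lemma unimodular_map_shear: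
  fixes j k :: "'n::finite"
  assumes "j \<noteq> k" "c \<in> \<int>"
  shows "unimodular_map (shear j k c)"
proof -
  have "linear (shear j k c)"
    by (rule linearI) (auto simp: vec_eq_iff algebra_simps)
  moreover have inv: "shear j k c (shear j k (- c) x) = x" "shear j k (- c) (shear j k c x) = x" for x
    using shear_shear_minus[OF assms(1), of c x] shear_shear_minus[OF assms(1), of "- c" x] by auto
  then have "bij (shear j k c)"
    by (intro bijI') (metis, metis)
  moreover have "shear j k d x \<in> int_lattice" if "d \<in> \<int>" "x \<in> int_lattice" for d x
    using that by (auto simp: int_lattice_def)
  then have "shear j k c ` int_lattice = int_lattice"
    using inv(1) assms(2) by (auto simp: image_iff) (metis Ints_minus)
  moreover have "measure lebesgue (shear j k c ` S) = measure lebesgue S" if "compact S" for S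
  proof (rule measure_eq_fibres[where j = j])
    show "compact (shear j k c ` S)" "compact S"
      using that \<open>linear (shear j k c)\<close> by (auto intro: compact_linear_image)
    fix x :: "real ^ 'n"
    let ?F = "{t. put j t x \<in> S}"
    have "put j t x = shear j k c (put j (t - c * x $ k) x)" for t
      using assms(1) by (simp add: vec_eq_iff)
    then have "put j t x \<in> shear j k c ` S \<longleftrightarrow> put j (t - c * x $ k) x \<in> S" for t
      using inj_image_mem_iff[OF bij_is_inj[OF \<open>bij (shear j k c)\<close>]] by metis
    then have "{t. put j t x \<in> shear j k c ` S} = {t. t - c * x $ k \<in> ?F}"
      by simp
    also have "\<dots> = (+) (c * x $ k) ` ?F"
      by (force simp: image_iff)
    finally have "{t. put j t x \<in> shear j k c ` S} = (+) (c * x $ k) ` ?F" .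
    then show "emeasure lborel {t. put j t x \<in> shear j k c ` S} = emeasure lborel ?F"
      by (simp add: emeasure_lborel_translation)
  qed
  ultimately show ?thesis
    by (simp add: unimodular_map_def)
qed

text \<open>One subtraction of the Euclidean algorithm: the signs in \<open>c\<close> move
  \<open>x $ j\<close> towards 0 by \<open>\<bar>x $ k\<bar>\<close>. For integral \<open>x\<close>
  the sum drops by at least 1, which makes the elimination below terminate.\<close>

lemma sum_abs_shear:
  assumes "finite T" "j \<in> T" "k \<in> T" "j \<noteq> k" "x $ k \<noteq> 0" "\<bar>x $ k\<bar> \<le> \<bar>x $ j\<bar>"
    and s: "c = - sgn (x $ j) * sgn (x $ k)"
  shows "(\<Sum>l\<in>T. \<bar>shear j k c x $ l\<bar>) = (\<Sum>l\<in>T. \<bar>x $ l\<bar>) - \<bar>x $ k\<bar>"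
proof -
  have "\<bar>x $ j + c * x $ k\<bar> = \<bar>x $ j\<bar> - \<bar>x $ k\<bar>"
    using assms(5,6) unfolding s by (auto simp: sgn_if abs_if split: if_splits)
  moreover have "(\<Sum>l\<in>T - {j}. \<bar>shear j k c x $ l\<bar>) = (\<Sum>l\<in>T - {j}. \<bar>x $ l\<bar>)"
    by (intro sum.cong) auto
  ultimately show ?thesis
    using assms(1,2) by (simp add: sum.remove[of T j])
qed

text \<open>The Euclidean algorithm on the coordinates in \<open>T\<close>.\<close>

lemma unimodular_elimination:
  fixes w :: "real ^ 'n"
  assumes "w \<in> int_lattice" "p \<in> T" "j \<in> T" "w $ j \<noteq> 0"
  obtains g where "unimodular_map g" "\<And>x. (\<And>l. l \<in> T \<Longrightarrow> x $ l = 0) \<Longrightarrow> g x = x"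
    "g w $ p \<noteq> 0" "\<And>l. l \<in> T \<Longrightarrow> l \<noteq> p \<Longrightarrow> g w $ l = 0"
proof -
  have "finite T" by simp
  define Q where "Q = (\<lambda>w g. unimodular_map g \<and> (\<forall>x. (\<forall>l\<in>T. x $ l = 0) \<longrightarrow> g x = x) \<and>
      g w $ p \<noteq> 0 \<and> (\<forall>l\<in>T. l \<noteq> p \<longrightarrow> g w $ l = 0))"
  \<comment> \<open>A map that works for the sheared vector, preceded by the shear, works for
    \<open>w\<close>. Vectors vanishing on \<open>T\<close> stay fixed because both indices of the
    shear lie in \<open>T\<close>.\<close>
  have Q_shear: "Q w (g \<circ> shear a b c)"
    if "Q (shear a b c w) g" "a \<in> T" "b \<in> T" "a \<noteq> b" "c \<in> \<int>" for w g a b c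
  proof -
    have "shear a b c x = x" if "\<forall>l\<in>T. x $ l = 0" for x
      using that \<open>a \<in> T\<close> \<open>b \<in> T\<close> by (auto simp: vec_eq_iff)
    moreover have "unimodular_map (g \<circ> shear a b c)"
      using that by (intro unimodular_map_compose[of g "shear a b c"] unimodular_map_shear) (auto simp: Q_def)
    ultimately show ?thesis
      using that(1) by (simp add: Q_def)
  qed
  have "\<exists>g. Q w g" if "(\<Sum>l\<in>T. \<bar>w $ l\<bar>) \<le> real m" "w \<in> int_lattice" "\<exists>j\<in>T. w $ j \<noteq> 0" for m w
    using that
  proof (induction m arbitrary: w rule: less_induct)
    case (less m)
    show ?case
    proof (cases "\<exists>j\<in>T. \<exists>k\<in>T. j \<noteq> k \<and> w $ j \<noteq> 0 \<and> w $ k \<noteq> 0")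
      case True
      then obtain j k where jk: "j \<in> T" "k \<in> T" "j \<noteq> k" "w $ k \<noteq> 0" "\<bar>w $ k\<bar> \<le> \<bar>w $ j\<bar>"
        by (metis linorder_le_cases)
      define c where "c = - sgn (w $ j) * sgn (w $ k)"
      define w' where "w' = shear j k c w"
      have c: "c \<in> \<int>"
        by (auto simp: c_def sgn_if)
      have "\<bar>w $ k\<bar> \<ge> 1"
        using less.prems(2) jk(4) Ints_nonzero_abs_ge1 by (auto simp: int_lattice_def)
      then have *: "(\<Sum>l\<in>T. \<bar>w' $ l\<bar>) \<le> real m - 1"
        using sum_abs_shear[OF \<open>finite T\<close> jk c_def] less.prems(1) by (simp add: w'_def)
      moreover have "0 \<le> (\<Sum>l\<in>T. \<bar>w' $ l\<bar>)"
        by (intro sum_nonneg) auto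
      ultimately have m: "m \<ge> 1" by linarith
      then have "(\<Sum>l\<in>T. \<bar>w' $ l\<bar>) \<le> real (m - 1)"
        using * by (simp add: of_nat_diff)
      moreover have "w' \<in> int_lattice"
        using unimodular_map_lattice[OF unimodular_map_shear[OF jk(3) c] less.prems(2)] by (simp add: w'_def)
      moreover have "\<exists>j\<in>T. w' $ j \<noteq> 0"
        using jk by (auto simp: w'_def)
      ultimately obtain g where "Q w' g"
        using less.IH[of "m - 1" w'] m by auto
      then show ?thesis
        using Q_shear[of j k c w g] jk c by (auto simp: w'_def)
    next
      case False
      obtain j where j: "j \<in> T" "w $ j \<noteq> 0" using less.prems by blast
      then have zero: "w $ l = 0" if "l \<in> T" "l \<noteq> j" for l
        using False that by blast
      show ?thesis
      proof (cases "j = p")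
        case True
        then have "Q w (\<lambda>x. x)"
          using j zero by (auto simp: Q_def unimodular_map_id)
        then show ?thesis by blast
      next
        case False
        \<comment> \<open>Only the \<open>j\<close>-th coordinate in \<open>T\<close> is nonzero:
          \<open>shear p j 1\<close> copies it to position \<open>p\<close>, then
          \<open>shear j p (- 1)\<close> clears position \<open>j\<close>.\<close>
        have "Q (shear j p (- 1) (shear p j 1 w)) (\<lambda>x. x)"
          using j zero False assms(2) by (auto simp: Q_def unimodular_map_id)
        from Q_shear[OF this] have "Q (shear p j 1 w) ((\<lambda>x. x) \<circ> shear j p (- 1))"
          using j assms(2) False by auto
        from Q_shear[OF this] have "Q w (((\<lambda>x. x) \<circ> shear j p (- 1)) \<circ> shear p j 1)"
          using j assms(2) False by auto
        then show ?thesis by blast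
      qed
    qed
  qed
  from this[of w "nat \<lceil>\<Sum>l\<in>T. \<bar>w $ l\<bar>\<rceil>"] assms obtain g where "Q w g"
    using real_nat_ceiling_ge by blast
  then show thesis
    using that[of g] by (auto simp: Q_def)
qed

subsection \<open>Shaking\<close>

text \<open>For compact convex \<open>K\<close> the condition says that \<open>x $ j\<close> lies
  between 0 and the length of the fibre through \<open>x\<close>, see \<open>fibre_shake\<close>.
  Asking for two points of \<open>K\<close> at this distance avoids the endpoints of the fibre and
  makes convexity and compactness direct.\<close>

definition shake :: "'n \<Rightarrow> (real ^ 'n) set \<Rightarrow> (real ^ 'n) set" where
  "shake j K = {x. 0 \<le> x $ j \<and> (\<exists>s. put j s x \<in> K \<and> put j (s + x $ j) x \<in> K)}"

lemma shakeI:
  assumes "y \<in> K" "0 \<le> t" "put j (y $ j + t) y \<in> K"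
  shows "put j t y \<in> shake j K"
  using assms by (auto simp: shake_def intro!: exI[of _ "y $ j"])

lemma shakeE:
  assumes "x \<in> shake j K"
  obtains y t where "x = put j t y" "0 \<le> t" "y \<in> K" "put j (y $ j + t) y \<in> K"
proof -
  obtain s where "0 \<le> x $ j" "put j s x \<in> K" "put j (s + x $ j) x \<in> K"
    using assms by (auto simp: shake_def)
  then show thesis
    by (intro that[of "x $ j" "put j s x"]) simp_all
qed

lemma put_zero_in_shake: "y \<in> K \<Longrightarrow> put j 0 y \<in> shake j K"
  by (rule shakeI) simp_all

lemma convex_shake:
  assumes "convex K"
  shows "convex (shake j K)"
proof (rule convexI)
  fix x y and u v :: real
  assume xy: "x \<in> shake j K" "y \<in> shake j K" and uv: "0 \<le> u" "0 \<le> v" "u + v = 1"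
  obtain s where s: "0 \<le> x $ j" "put j s x \<in> K" "put j (s + x $ j) x \<in> K"
    using xy(1) by (auto simp: shake_def)
  obtain t where t: "0 \<le> y $ j" "put j t y \<in> K" "put j (t + y $ j) y \<in> K"
    using xy(2) by (auto simp: shake_def)
  let ?z = "u *\<^sub>R x + v *\<^sub>R y"
  have "put j (u * s + v * t) ?z \<in> K" "put j (u * (s + x $ j) + v * (t + y $ j)) ?z \<in> K"
    unfolding put_convex_comb using s t uv assms by (auto intro: convexD)
  moreover have "u * (s + x $ j) + v * (t + y $ j) = u * s + v * t + ?z $ j"
    by (simp add: algebra_simps)
  moreover have "0 \<le> ?z $ j"
    using s(1) t(1) uv by simp
  ultimately show "?z \<in> shake j K"
    unfolding shake_def by (auto simp del: vector_add_component)
qed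

text \<open>The shaken set is the continuous image of a compact set: the pairs of points of
  \<open>K\<close> on a common fibre, the first not above the second, are sent to the point of that
  fibre whose height is their distance.\<close>

lemma compact_shake:
  assumes "compact K"
  shows "compact (shake j K)"
proof -
  let ?C = "K \<times> K \<inter> {p. fst p $ j \<le> snd p $ j} \<inter> {p. put j 0 (fst p) = put j 0 (snd p)}"
  let ?f = "\<lambda>p :: (real ^ 'a) \<times> (real ^ 'a). put j (snd p $ j - fst p $ j) (fst p)"
  have "compact ?C"
    by (intro compact_Int_closed compact_Times assms closed_Collect_le closed_Collect_eq continuous_intros)
  then have "compact (?f ` ?C)"
    by (intro compact_continuous_image continuous_intros)
  also have "?f ` ?C = shake j K"
  proof (intro equalityI subsetI)
    fix x assume "x \<in> ?f ` ?C"
    then obtain y z where yz: "y \<in> K" "z \<in> K" "y $ j \<le> z $ j" "put j 0 y = put j 0 z"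
        "x = put j (z $ j - y $ j) y"
      by auto
    have "put j (z $ j) (put j 0 y) = put j (z $ j) (put j 0 z)"
      by (simp only: yz(4))
    then have "put j (z $ j) y = z" by simp
    with yz show "x \<in> shake j K"
      by (auto intro!: shakeI)
  next
    fix x assume "x \<in> shake j K"
    then obtain y t where yt: "x = put j t y" "0 \<le> t" "y \<in> K" "put j (y $ j + t) y \<in> K"
      by (rule shakeE)
    then show "x \<in> ?f ` ?C"
      by (intro image_eqI[of _ _ "(y, put j (y $ j + t) y)"]) auto
  qed
  finally show ?thesis .
qed

lemma compact_fibre:
  assumes "compact K"
  shows "compact {t. put j t x \<in> K}"
proof -
  have "closed ((\<lambda>t. put j t x) -` K)"
    using assms by (intro closed_vimage compact_imp_closed continuous_intros)
  moreover obtain B where B: "\<And>y. y \<in> K \<Longrightarrow> norm y \<le> B"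
    using compact_imp_bounded[OF assms] by (auto simp: bounded_iff)
  have "\<bar>t\<bar> \<le> B" if "put j t x \<in> K" for t
    using B[OF that] component_le_norm_cart[of "put j t x" j] by simp
  then have "bounded ((\<lambda>t. put j t x) -` K)"
    by (auto simp: bounded_iff)
  ultimately show ?thesis
    by (simp add: compact_eq_bounded_closed vimage_def)
qed

lemma convex_fibre:
  assumes "convex K"
  shows "convex {t. put j t x \<in> K}"
proof (rule convexI)
  fix s t and u v :: real
  assume *: "s \<in> {t. put j t x \<in> K}" "t \<in> {t. put j t x \<in> K}" "0 \<le> u" "0 \<le> v" "u + v = 1"
  have "put j (u * s + v * t) x = u *\<^sub>R put j s x + v *\<^sub>R put j t x"
    using put_convex_comb[of j u s v t x x] * by (simp flip: scaleR_add_left)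
  with * assms show "u *\<^sub>R s + v *\<^sub>R t \<in> {t. put j t x \<in> K}"
    by (auto intro: convexD)
qed

lemma put_between:
  assumes "convex K" "put j s x \<in> K" "put j r x \<in> K" "s \<le> t" "t \<le> r"
  shows "put j t x \<in> K"
proof -
  have "closed_segment s r \<subseteq> {t. put j t x \<in> K}"
    using assms(2,3) by (intro closed_segment_subset convex_fibre[OF assms(1)]) simp_all
  then show ?thesis
    using assms(4,5) by (auto simp: closed_segment_eq_real_ivl)
qed

lemma fibre_interval:
  assumes "compact K" "convex K"
  obtains a b where "{t. put j t x \<in> K} = {a..b}"
  using connected_compact_interval_1[of "{t. put j t x \<in> K}"]
    compact_fibre[OF assms(1)] convex_connected[OF convex_fibre[OF assms(2)]] by blast

text \<open>An empty fibre is included: then \<open>b < a\<close>, and the interval on the right is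
  empty as well.\<close>

lemma fibre_shake:
  assumes "{t. put j t x \<in> K} = {a..b}"
  shows "{t. put j t x \<in> shake j K} = {0..b - a}"
proof -
  have mem: "put j t x \<in> K \<longleftrightarrow> a \<le> t \<and> t \<le> b" for t
    using assms by (metis atLeastAtMost_iff mem_Collect_eq)
  show ?thesis
    by (auto simp: shake_def mem intro!: exI[of _ a])
qed

lemma measure_shake:
  assumes "compact K" "convex K"
  shows "measure lebesgue (shake j K) = measure lebesgue K"
proof (rule measure_eq_fibres[where j = j])
  show "compact (shake j K)" "compact K"
    using assms by (auto intro: compact_shake)
  fix x :: "real ^ 'a"
  obtain a b where ab: "{t. put j t x \<in> K} = {a..b}"
    using assms by (rule fibre_interval)
  show "emeasure lborel {t. put j t x \<in> shake j K} = emeasure lborel {t. put j t x \<in> K}"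
    unfolding ab fibre_shake[OF ab] by (cases "a \<le> b") simp_all
qed

text \<open>A compact convex set has nonempty interior exactly if its volume is nonzero, and shaking
  keeps the volume.\<close>

lemma convex_body_shake:
  assumes "convex_body K"
  shows "convex_body (shake j K)"
proof -
  have K: "compact K" "convex K" "interior K \<noteq> {}"
    using assms by (auto simp: convex_body_def)
  have S: "compact (shake j K)" "convex (shake j K)"
    using K by (auto intro: compact_shake convex_shake)
  have neg: "interior C = {} \<longleftrightarrow> measure lebesgue C = 0" if "compact C" "convex C" for C :: "(real ^ 'a) set"
    using that negligible_convex_interior[of C] negligible_iff_measure[of C] lmeasurable_compact[of C] by auto
  show ?thesis
    using K S neg measure_shake[OF K(1,2), of j] by (simp add: convex_body_def)
qed

section \<open>Lattice points under shaking\<close>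

lemma lattice_count_le_shake:
  assumes "compact K"
  shows "lattice_count K \<le> lattice_count (shake j K)"
proof -
  let ?Z = "int_lattice :: (real ^ 'a) set"
  have fin: "finite (K \<inter> ?Z)" "finite (shake j K \<inter> ?Z)"
    using assms by (auto intro: finite_lattice_bounded compact_imp_bounded compact_shake)
  \<comment> \<open>\<open>put j 0 x\<close> labels the fibre through \<open>x\<close>, and
    \<open>m\<close> is the height of the lowest lattice point of \<open>K\<close> on it.
    Subtracting this integer turns each height into a distance between two points of
    \<open>K\<close> on the fibre, hence lands in \<open>shake j K\<close>; the shift is constant on
    fibres, so \<open>f\<close> is injective.\<close>
  define m where "m = (\<lambda>x. Min ((\<lambda>y. y $ j) ` {y \<in> K \<inter> ?Z. put j 0 y = x}))"
  define f where "f = (\<lambda>x. put j (x $ j - m (put j 0 x)) x)"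
  have "f ` (K \<inter> ?Z) \<subseteq> shake j K \<inter> ?Z"
  proof (rule image_subsetI)
    fix x assume x: "x \<in> K \<inter> ?Z"
    let ?F = "{y \<in> K \<inter> ?Z. put j 0 y = put j 0 x}"
    have "finite ?F" "x \<in> ?F"
      using x by (auto intro: finite_subset[OF _ fin(1)])
    then have "m (put j 0 x) \<in> (\<lambda>y. y $ j) ` ?F" "m (put j 0 x) \<le> x $ j"
      unfolding m_def by (auto intro!: Min_in Min_le)
    then obtain y where y: "y \<in> K" "y \<in> ?Z" "put j 0 y = put j 0 x" "m (put j 0 x) = y $ j" "y $ j \<le> x $ j"
      by auto
    have put: "put j t y = put j t x" for t
      using y(3) by (metis put_put)
    have "put j (y $ j + (x $ j - y $ j)) y = x"
      by (simp add: put)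
    then have "put j (x $ j - y $ j) y \<in> shake j K"
      using x y by (intro shakeI) auto
    then show "f x \<in> shake j K \<inter> ?Z"
      using x y by (auto simp: f_def put int_lattice_def)
  qed
  moreover have "inj_on f (K \<inter> ?Z)"
  proof (rule inj_onI)
    fix x y assume "f x = f y"
    then have "put j 0 (f x) = put j 0 (f y)" "f x $ j = f y $ j"
      by auto
    then have "put j 0 x = put j 0 y" "x $ j = y $ j"
      by (auto simp: f_def)
    then show "x = y"
      by (metis put_put put_self)
  qed
  ultimately show ?thesis
    unfolding lattice_count_def using fin(2) by (metis card_inj_on_le)
qed

lemma interior_inner_less:
  fixes u :: "'a::euclidean_space"
  assumes "x \<in> interior S" "u \<noteq> 0"
  obtains y where "y \<in> S" "inner u y < inner u x"
proof -
  obtain e where e: "e > 0" "cball x e \<subseteq> S"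
    using assms(1) by (metis mem_interior_cball)
  have "x - (e / norm u) *\<^sub>R u \<in> S"
    using e assms(2) by (auto simp: subset_iff dist_norm)
  moreover have "inner u (x - (e / norm u) *\<^sub>R u) < inner u x"
    using e assms(2) by (simp add: inner_diff_right)
  ultimately show thesis by (rule that)
qed

text \<open>A hyperplane supporting \<open>K\<close> inside a fibre contains the whole fibre, hence would also support
  \<open>shake j K\<close> at \<open>x\<close>.\<close>

lemma fibre_subset_interior:
  assumes "convex_body K" "x \<in> interior (shake j K)"
    and s: "put j s x \<in> K" "s < t" "t < r" "put j r x \<in> K"
  shows "put j t x \<in> interior K"
proof (rule ccontr)
  assume notin: "put j t x \<notin> interior K"
  have K: "convex K" "interior K \<noteq> {}"
    using assms(1) by (auto simp: convex_body_def)
  have "put j t x \<in> K"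
    using s by (intro put_between[OF K(1) s(1,4)]) auto
  moreover have "put j t x \<notin> rel_interior K"
    using notin K by (simp add: rel_interior_nonempty_interior)
  ultimately obtain u where u: "u \<noteq> 0" "\<And>y. y \<in> K \<Longrightarrow> inner u (put j t x) \<le> inner u y"
    using supporting_hyperplane_rel_boundary[OF K(1)] by metis
  have inner_put: "inner u (put j t y) = inner u y + (t - y $ j) * u $ j" for t y
    by (simp add: put_eq_add_axis inner_add_right inner_axis)
  \<comment> \<open>The fibre extends to both sides of the height \<open>t\<close>, so the
    supporting functional can neither increase nor decrease along it.\<close>
  have "0 \<le> (s - t) * u $ j" "0 \<le> (r - t) * u $ j"
    using u(2)[OF s(1)] u(2)[OF s(4)] by (simp_all add: inner_put algebra_simps)
  then have "u $ j = 0"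
    using s(2,3) by (auto simp: zero_le_mult_iff)
  obtain y where y: "y \<in> shake j K" "inner u y < inner u x"
    using assms(2) u(1) by (rule interior_inner_less)
  then obtain z where "put j z y \<in> K"
    by (auto simp: shake_def)
  then show False
    using u(2)[of "put j z y"] y(2) \<open>u $ j = 0\<close> by (simp add: inner_put)
qed

text \<open>Over a fibre \<open>{l..r}\<close> a lattice point in the interior of the shaken body
  has an integral height \<open>h\<close> with \<open>1 \<le> h\<close> and
  \<open>h < r - l\<close>. Adding the floor of \<open>l\<close> gives an integer strictly between
  \<open>l\<close> and \<open>r\<close>, and \<open>fibre_subset_interior\<close> applies.\<close>

lemma lattice_count_interior_shake_le:
  assumes "convex_body K"
  shows "lattice_count (interior (shake j K)) \<le> lattice_count (interior K)"
proof -
  let ?Z = "int_lattice :: (real ^ 'a) set"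
  have K: "compact K" "convex K"
    using assms by (auto simp: convex_body_def)
  have fin: "finite (interior K \<inter> ?Z)"
    using K by (auto intro: finite_lattice_bounded compact_imp_bounded bounded_interior)
  define a where "a = (\<lambda>x. Inf {t. put j t x \<in> K})"
  define f where "f = (\<lambda>x. put j (x $ j + of_int \<lfloor>a (put j 0 x)\<rfloor>) x)"
  have "f ` (interior (shake j K) \<inter> ?Z) \<subseteq> interior K \<inter> ?Z"
  proof (rule image_subsetI)
    fix x assume x: "x \<in> interior (shake j K) \<inter> ?Z"
    obtain l r where lr: "{t. put j t x \<in> K} = {l..r}"
      using K by (rule fibre_interval)
    obtain e where e: "e > 0" "cball x e \<subseteq> shake j K"
      using x by (metis Int_iff mem_interior_cball)
    \<comment> \<open>Moving by \<open>e\<close> up and down the axis stays in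
      \<open>shake j K\<close>, which makes the bounds 0 and \<open>r - l\<close> on the height
      strict.\<close>
    have "put j (x $ j + c) x \<in> shake j K" if "\<bar>c\<bar> \<le> e" for c
      using e that by (intro subsetD[OF e(2)]) (simp add: put_eq_add_axis dist_norm)
    from this[of e] this[of "- e"] have "x $ j + e \<in> {0..r - l}" "x $ j - e \<in> {0..r - l}"
      using e unfolding fibre_shake[OF lr, symmetric] by auto
    then have pos: "0 < x $ j" "x $ j < r - l" "l \<le> r"
      using e by auto
    then have "1 \<le> x $ j"
      using x Ints_nonzero_abs_ge1[of "x $ j"] by (auto simp: int_lattice_def)
    have "a (put j 0 x) = l"
      using pos by (simp add: a_def lr)
    moreover have "l < x $ j + of_int \<lfloor>l\<rfloor>" "x $ j + of_int \<lfloor>l\<rfloor> < r"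
      using \<open>1 \<le> x $ j\<close> pos by linarith+
    moreover have "put j l x \<in> K" "put j r x \<in> K"
      using lr pos by (metis (no_types, lifting) atLeastAtMost_iff mem_Collect_eq order_refl)+
    ultimately have "f x \<in> interior K"
      unfolding f_def using x by (metis IntD1 assms fibre_subset_interior)
    moreover have "f x \<in> ?Z"
      using x by (auto simp: f_def int_lattice_def)
    ultimately show "f x \<in> interior K \<inter> ?Z" by simp
  qed
  moreover have "inj_on f (interior (shake j K) \<inter> ?Z)"
  proof (rule inj_onI)
    fix x y assume "f x = f y"
    then have "put j 0 (f x) = put j 0 (f y)" "f x $ j = f y $ j"
      by auto
    then have "put j 0 x = put j 0 y" "x $ j = y $ j"
      by (auto simp: f_def)
    then show "x = y"
      by (metis put_put put_self)
  qed
  ultimately show ?thesis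
    unfolding lattice_count_def using fin by (metis card_inj_on_le)
qed

section \<open>Half difference bodies under shaking\<close>

lemma put_zero_in_cs_shake:
  assumes "v \<in> cs K"
  shows "put j 0 v \<in> cs (shake j K)"
proof -
  obtain x y where "x \<in> K" "y \<in> K" "v = (1/2) *\<^sub>R (x - y)"
    using assms by (auto simp: cs_def)
  moreover from this have "put j 0 v = (1/2) *\<^sub>R (put j 0 x - put j 0 y)"
    by (simp add: vec_eq_iff)
  ultimately show ?thesis
    unfolding cs_def by (blast intro: put_zero_in_shake)
qed

text \<open>Two points of \<open>K\<close> whose difference is parallel to the axis lie on one
  fibre; shaking preserves their distance when the lower one is sent to height 0.\<close>

lemma axis_in_cs_shake:
  assumes "v \<in> cs K" "\<And>l. l \<noteq> j \<Longrightarrow> v $ l = 0"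
  shows "v \<in> cs (shake j K)"
proof -
  \<comment> \<open>Both signs are proved together, so that either of the two points may be the
    lower one.\<close>
  have shaken: "(1/2) *\<^sub>R (y - x) \<in> cs (shake j K) \<and> (1/2) *\<^sub>R (x - y) \<in> cs (shake j K)"
    if "x \<in> K" "y \<in> K" "x $ j \<le> y $ j" "\<And>l. l \<noteq> j \<Longrightarrow> x $ l = y $ l" for x y
  proof -
    have "put j (x $ j + (y $ j - x $ j)) x = y"
      using that(4) by (simp add: vec_eq_iff)
    then have "put j (y $ j - x $ j) x \<in> shake j K"
      using that by (intro shakeI) auto
    moreover have "put j 0 x \<in> shake j K"
      using that(1) by (rule put_zero_in_shake)
    moreover have "y - x = put j (y $ j - x $ j) x - put j 0 x"
      using that(4) by (simp add: vec_eq_iff)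
    moreover from this have "x - y = put j 0 x - put j (y $ j - x $ j) x"
      by (metis minus_diff_eq)
    ultimately show ?thesis
      unfolding cs_def by auto
  qed
  obtain x y where xy: "x \<in> K" "y \<in> K" "v = (1/2) *\<^sub>R (x - y)"
    using assms(1) by (auto simp: cs_def)
  then have "x $ l = y $ l" if "l \<noteq> j" for l
    using assms(2)[OF that] by simp
  then show ?thesis
    using shaken[of x y] shaken[of y x] xy by (metis linorder_le_cases)
qed

section \<open>Downward closure under shaking\<close>

definition downward_closed_along :: "'n \<Rightarrow> (real ^ 'n) set \<Rightarrow> bool" where
  "downward_closed_along i K \<longleftrightarrow>
    (\<forall>x\<in>K. 0 \<le> x $ i \<and> (\<forall>s. 0 \<le> s \<longrightarrow> s \<le> x $ i \<longrightarrow> put i s x \<in> K))"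

lemma downward_closed_along_shake_same:
  assumes "convex K"
  shows "downward_closed_along j (shake j K)"
  unfolding downward_closed_along_def
proof (intro ballI conjI allI impI)
  fix x s assume x: "x \<in> shake j K"
  then show "0 \<le> x $ j" by (simp add: shake_def)
  assume s: "0 \<le> s" "s \<le> x $ j"
  obtain r where r: "put j r x \<in> K" "put j (r + x $ j) x \<in> K"
    using x by (auto simp: shake_def)
  have "put j (r + s) x \<in> K"
    using s by (intro put_between[OF assms r]) auto
  with r s show "put j s x \<in> shake j K"
    by (auto simp: shake_def)
qed

text \<open>Lowering the \<open>i\<close>-th coordinate can be done at both ends of the chord along
  \<open>j\<close> that witnesses membership in \<open>shake j K\<close>, and changes of different
  coordinates commute.\<close>

lemma downward_closed_along_shake_other:
  assumes "downward_closed_along i K" "i \<noteq> j"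
  shows "downward_closed_along i (shake j K)"
  unfolding downward_closed_along_def
proof (intro ballI conjI allI impI)
  fix x s assume x: "x \<in> shake j K"
  then obtain r where r: "0 \<le> x $ j" "put j r x \<in> K" "put j (r + x $ j) x \<in> K"
    by (auto simp: shake_def)
  then have "0 \<le> put j r x $ i"
    using assms(1) by (auto simp only: downward_closed_along_def)
  then show "0 \<le> x $ i"
    using assms(2) by simp
  assume "0 \<le> s" "s \<le> x $ i"
  then have "put i s (put j r x) \<in> K" "put i s (put j (r + x $ j) x) \<in> K"
    using assms r by (auto simp: downward_closed_along_def)
  then show "put i s x \<in> shake j K"
    using r(1) assms(2) by (auto simp: shake_def put_commute[of i j])
qed

lemma anti_blocking_if_downward_closed_along:
  assumes "convex_body K" "\<And>i. downward_closed_along i K"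
  shows "anti_blocking K"
  unfolding anti_blocking_def
proof (intro conjI ballI subsetI assms)
  show "x \<in> {x. \<forall>i. 0 \<le> x $ i}" if "x \<in> K" for x
    using assms(2) that by (auto simp: downward_closed_along_def)
  fix x x' assume x: "x \<in> K" "x' \<in> {x'. (\<forall>i. 0 \<le> x' $ i) \<and> (\<forall>i. x' $ i \<le> x $ i)}"
  \<comment> \<open>Coordinates are lowered one at a time: outside \<open>T\<close> the entry is
    still that of \<open>x\<close>, so each step goes downward.\<close>
  have "(\<chi> l. if l \<in> T then x' $ l else x $ l) \<in> K" if "finite T" for T
    using that
  proof (induction T rule: finite_induct)
    case empty
    then show ?case using x by simp
  next
    case (insert i T)
    let ?y = "\<chi> l. if l \<in> T then x' $ l else x $ l"
    have "put i (x' $ i) ?y \<in> K"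
      using insert x assms(2)[of i] by (auto simp: downward_closed_along_def)
    also have "put i (x' $ i) ?y = (\<chi> l. if l \<in> insert i T then x' $ l else x $ l)"
      by (auto simp: vec_eq_iff)
    finally show ?case .
  qed
  from this[of UNIV] show "x' \<in> K" by simp
qed

subsection \<open>Successive minima\<close>

lemma dim_coordinate_subspace:
  "dim {x :: real ^ 'n. \<forall>i. i \<notin> d \<longrightarrow> x $ i = 0} = card d"
proof -
  have "dim {x :: real ^ 'n. \<forall>b\<in>Basis. b \<notin> (\<lambda>i. axis i 1) ` d \<longrightarrow> inner x b = 0} = card ((\<lambda>i. axis i (1 :: real)) ` d :: (real ^ 'n) set)"
    by (rule dim_substandard) (auto simp: axis_in_Basis_iff)
  also have "{x :: real ^ 'n. \<forall>b\<in>Basis. b \<notin> (\<lambda>i. axis i 1) ` d \<longrightarrow> inner x b = 0} = {x. \<forall>i. i \<notin> d \<longrightarrow> x $ i = 0}"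
    by (auto simp: Basis_vec_def inner_axis axis_eq_axis)
  also have "card ((\<lambda>i. axis i (1 :: real)) ` d :: (real ^ 'n) set) = card d"
    by (intro card_image inj_onI) (simp add: axis_eq_axis)
  finally show ?thesis .
qed

text \<open>Here \<open>r\<close> numbers the coordinates, as the index type has no order. In the
  induction step the lattice points of the dilate for the next minimum span more than
  \<open>k\<close> dimensions, so the image of one of them has a nonzero coordinate numbered above
  \<open>k\<close>; elimination leaves a single such coordinate. The minima stay those of
  \<open>K\<close>; only the vectors move with \<open>g\<close>.\<close>

lemma lattice_flag:
  fixes K :: "(real ^ 'n) set" and r :: "'n \<Rightarrow> nat"
  assumes K: "convex_body K" and r: "bij_betw r UNIV {1..CARD('n)}" and "k \<le> CARD('n)"
  shows "\<exists>g w. unimodular_map g \<and>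
    (\<forall>i. r i \<le> k \<longrightarrow> w i \<in> cs (g ` K) \<and> successive_min (r i) K *\<^sub>R w i \<in> int_lattice \<and>
      w i $ i \<noteq> 0 \<and> (\<forall>l. r i < r l \<longrightarrow> w i $ l = 0))"
  using \<open>k \<le> CARD('n)\<close>
proof (induction k)
  case 0
  have "\<not> r i \<le> 0" for i
    using bij_betwE[OF r, rule_format, OF UNIV_I, of i] by simp
  then show ?case
    using unimodular_map_id by blast
next
  case (Suc k)
  define L where "L = (\<lambda>i. successive_min i K)"
  from Suc obtain g w where g: "unimodular_map g"
    and w: "\<And>i. r i \<le> k \<Longrightarrow> w i \<in> cs (g ` K) \<and> L (r i) *\<^sub>R w i \<in> int_lattice \<and>
      w i $ i \<noteq> 0 \<and> (\<forall>l. r i < r l \<longrightarrow> w i $ l = 0)"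
    unfolding L_def by (metis Suc_leD)
  have inj: "inj r" using r by (rule bij_betw_imp_inj_on)
  obtain p where p: "r p = Suc k"
    using bij_betw_imp_surj_on[OF r] Suc.prems by (metis atLeastAtMost_iff imageE le_add1 plus_1_eq_Suc)
  define F where "F = (*\<^sub>R) (L (Suc k)) ` cs K \<inter> int_lattice"
  have "Suc k \<le> dim F"
    using sym_successive_minimum(1)[OF convex_body_cs[OF K], of "Suc k"] Suc.prems
    by (simp add: L_def F_def successive_min_def)
  moreover have "dim (g ` F) = dim F"
    using g by (intro dim_image_eq) (auto simp: unimodular_map_linear intro: inj_on_subset[OF unimodular_map_inj])
  moreover have "dim {x :: real ^ 'n. \<forall>i. i \<notin> {i. r i \<le> k} \<longrightarrow> x $ i = 0} = card {i. r i \<le> k}"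
    by (rule dim_coordinate_subspace)
  moreover have "card {i. r i \<le> k} \<le> k"
  proof -
    have "r ` {i. r i \<le> k} \<subseteq> {1..k}"
      using bij_betwE[OF r] by auto
    then have "card (r ` {i. r i \<le> k}) \<le> card {1..k}"
      by (rule card_mono[rotated]) simp
    then show ?thesis
      using inj by (simp add: card_image inj_on_subset)
  qed
  ultimately have "\<not> g ` F \<subseteq> {x. \<forall>i. i \<notin> {i. r i \<le> k} \<longrightarrow> x $ i = 0}"
    using dim_subset[of "g ` F" "{x. \<forall>i. i \<notin> {i. r i \<le> k} \<longrightarrow> x $ i = 0}"] by linarith
  then obtain v j where v: "v \<in> F" "k < r j" "g v $ j \<noteq> 0"
    by (auto simp: not_le)
  obtain c where c: "c \<in> cs K" "v = L (Suc k) *\<^sub>R c" "v \<in> int_lattice"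
    using v(1) by (auto simp: F_def)
  have "g v \<in> int_lattice"
    using g c(3) by (rule unimodular_map_lattice)
  \<comment> \<open>Elimination is confined to the coordinates numbered above \<open>k\<close>, so
    it fixes the earlier \<open>w i\<close>, which vanish there.\<close>
  moreover define T where "T = {l. k < r l}"
  moreover have "p \<in> T" "j \<in> T"
    using p v(2) by (auto simp: T_def)
  ultimately obtain h where h: "unimodular_map h" "\<And>x. (\<And>l. l \<in> T \<Longrightarrow> x $ l = 0) \<Longrightarrow> h x = x"
    "h (g v) $ p \<noteq> 0" "\<And>l. l \<in> T \<Longrightarrow> l \<noteq> p \<Longrightarrow> h (g v) $ l = 0"
    using unimodular_elimination[OF _ _ _ v(3)] by metis
  have hg: "unimodular_map (h \<circ> g)"
    using h(1) g by (rule unimodular_map_compose)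
  have scale: "h (g v) = L (Suc k) *\<^sub>R h (g c)"
    using linear_scale[OF unimodular_map_linear[OF hg], of "L (Suc k)" c] by (simp add: c(2))
  define w' where "w' = (\<lambda>i. if i = p then h (g c) else w i)"
  have "w' i \<in> cs ((h \<circ> g) ` K) \<and> L (r i) *\<^sub>R w' i \<in> int_lattice \<and>
      w' i $ i \<noteq> 0 \<and> (\<forall>l. r i < r l \<longrightarrow> w' i $ l = 0)" if i: "r i \<le> Suc k" for i
  proof (cases "i = p")
    case True
    have "h (g c) \<in> cs ((h \<circ> g) ` K)"
      using unimodular_image_cs[OF hg c(1)] by simp
    moreover have "h (g v) \<in> int_lattice"
      using unimodular_map_lattice[OF hg c(3)] by simp
    moreover have "L (Suc k) \<noteq> 0"
      using h(3) scale by auto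
    moreover have "h (g c) $ l = 0" if "Suc k < r l" for l
    proof -
      have "h (g v) $ l = 0"
        using that p by (intro h(4)) (auto simp: T_def)
      with \<open>L (Suc k) \<noteq> 0\<close> show ?thesis
        by (simp add: scale)
    qed
    ultimately show ?thesis
      using h(3) by (simp add: True w'_def p scale)
  next
    case False
    then have "r i \<noteq> r p" using inj by (auto simp: inj_eq)
    then have "r i \<le> k" using i p by simp
    note wi = w[OF this]
    have "h (w i) = w i"
      using wi \<open>r i \<le> k\<close> by (intro h(2)) (auto simp: T_def)
    moreover have "h (w i) \<in> cs (h ` g ` K)"
      using wi h(1) by (intro unimodular_image_cs) auto
    ultimately show ?thesis
      using wi False by (simp add: w'_def image_comp)
  qed
  with hg show ?case
    unfolding L_def by blast
qed

text \<open>The axes are shaken in the order of \<open>r\<close>. After \<open>k\<close> rounds each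
  \<open>w i\<close>, with its coordinates numbered up to \<open>k\<close> other than the
  \<open>i\<close>-th replaced by 0, lies in \<open>cs B\<close>; after all rounds only a multiple
  of an axis vector is left.\<close>

lemma iterated_shake:
  fixes K :: "(real ^ 'n) set" and r :: "'n \<Rightarrow> nat"
  assumes K: "convex_body K" and r: "bij_betw r UNIV {1..CARD('n)}" and "k \<le> CARD('n)"
    and w: "\<And>i. w i \<in> cs K" "\<And>i l. r i < r l \<Longrightarrow> w i $ l = 0"
  shows "\<exists>B. convex_body B \<and> measure lebesgue B = measure lebesgue K \<and>
    lattice_count K \<le> lattice_count B \<and>
    lattice_count (interior B) \<le> lattice_count (interior K) \<and>
    (\<forall>i. r i \<le> k \<longrightarrow> downward_closed_along i B) \<and>
    (\<forall>i. (\<chi> l. if r l \<le> k \<and> l \<noteq> i then 0 else w i $ l) \<in> cs B)"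
  using \<open>k \<le> CARD('n)\<close>
proof (induction k)
  case 0
  have "0 < r i" for i
    using bij_betwE[OF r, rule_format, OF UNIV_I, of i] by simp
  then show ?case
    using K w by (intro exI[of _ K]) (simp flip: neq0_conv add: vec_lambda_eta)
next
  case (Suc k)
  then obtain B where B: "convex_body B" "measure lebesgue B = measure lebesgue K"
    "lattice_count K \<le> lattice_count B" "lattice_count (interior B) \<le> lattice_count (interior K)"
    "\<And>i. r i \<le> k \<Longrightarrow> downward_closed_along i B"
    and wB: "\<And>i. (\<chi> l. if r l \<le> k \<and> l \<noteq> i then 0 else w i $ l) \<in> cs B"
    using Suc_leD by blast
  have cB: "compact B" "convex B"
    using B(1) by (auto simp: convex_body_def)
  have inj: "inj r" using r by (rule bij_betw_imp_inj_on)
  obtain p where p: "r p = Suc k"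
    using bij_betw_imp_surj_on[OF r] Suc.prems by (metis atLeastAtMost_iff imageE le_add1 plus_1_eq_Suc)
  have rp: "r l \<le> Suc k \<longleftrightarrow> r l \<le> k \<or> l = p" for l
    using p inj by (metis injD le_Suc_eq)
  have "downward_closed_along i (shake p B)" if "r i \<le> Suc k" for i
    using that rp B(5) cB downward_closed_along_shake_same downward_closed_along_shake_other by metis
  moreover have "(\<chi> l. if r l \<le> Suc k \<and> l \<noteq> i then 0 else w i $ l) \<in> cs (shake p B)" for i
  proof (cases "i = p")
    case True
    let ?v = "\<chi> l. if r l \<le> k \<and> l \<noteq> i then 0 else w i $ l"
    \<comment> \<open>When the turn of \<open>i\<close> itself comes, the coordinates numbered below
      \<open>r i\<close> are already cleared and those above vanish by assumption, so the vector
      lies on the shaken axis.\<close>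
    have "?v $ l = 0" if "l \<noteq> p" for l
      using that w(2)[of p l] True rp[of l] p by auto
    then have "?v \<in> cs (shake p B)"
      using wB by (intro axis_in_cs_shake)
    also have "?v = (\<chi> l. if r l \<le> Suc k \<and> l \<noteq> i then 0 else w i $ l)"
      using True by (auto simp: vec_eq_iff rp)
    finally show ?thesis .
  next
    case False
    have "put p 0 (\<chi> l. if r l \<le> k \<and> l \<noteq> i then 0 else w i $ l) \<in> cs (shake p B)"
      using wB by (rule put_zero_in_cs_shake)
    also have "put p 0 (\<chi> l. if r l \<le> k \<and> l \<noteq> i then 0 else w i $ l)
        = (\<chi> l. if r l \<le> Suc k \<and> l \<noteq> i then 0 else w i $ l)"
      using False by (auto simp: vec_eq_iff rp)
    finally show ?thesis .
  qed
  ultimately show ?case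
    using B convex_body_shake[OF B(1), of p] measure_shake[OF cB, of p] lattice_count_le_shake[OF cB(1), of p]
      lattice_count_interior_shake_le[OF B(1), of p]
    by (intro exI[of _ "shake p B"]) auto
qed

text \<open>Nonzero multiples of the \<open>k\<close> axis vectors numbered up to \<open>k\<close>
  are independent, so \<open>t\<close> competes in the minimum that defines the \<open>k\<close>-th
  successive minimum.\<close>

lemma successive_min_le_if_axes:
  fixes A :: "(real ^ 'n) set" and r :: "'n \<Rightarrow> nat"
  assumes A: "convex_body A" and r: "bij_betw r UNIV {1..CARD('n)}" and k: "k \<in> {1..CARD('n)}"
    and "0 < t"
    and ax: "\<And>i. r i \<le> k \<Longrightarrow> \<exists>m. m \<noteq> 0 \<and> m *\<^sub>R axis i 1 \<in> (*\<^sub>R) t ` cs A \<inter> int_lattice"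
  shows "successive_min k A \<le> t"
proof -
  let ?S = "(*\<^sub>R) t ` cs A \<inter> int_lattice"
  have "{x. \<forall>i. i \<notin> {i. r i \<le> k} \<longrightarrow> x $ i = 0} \<subseteq> span ?S"
  proof (rule subsetI, drule CollectD)
    fix x :: "real ^ 'n" assume x: "\<forall>i. i \<notin> {i. r i \<le> k} \<longrightarrow> x $ i = 0"
    have "x $ i *\<^sub>R axis i 1 \<in> span ?S" for i
    proof (cases "r i \<le> k")
      case True
      then obtain m where m: "m \<noteq> 0" "m *\<^sub>R axis i 1 \<in> ?S" using ax by blast
      then have "(x $ i / m) *\<^sub>R (m *\<^sub>R axis i 1) \<in> span ?S"
        by (intro span_scale span_base)
      then show ?thesis using m(1) by simp
    next
      case False
      then show ?thesis using x by (simp add: span_zero)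
    qed
    then have "(\<Sum>i\<in>UNIV. x $ i *\<^sub>R axis i 1) \<in> span ?S"
      by (intro span_sum)
    then show "x \<in> span ?S"
      using basis_expansion[of x] by (simp add: scalar_mult_eq_scaleR)
  qed
  from dim_subset[OF this] have "card {i. r i \<le> k} \<le> dim ?S"
    by (simp only: dim_coordinate_subspace dim_span)
  moreover have "card {i. r i \<le> k} = k"
  proof -
    have "1 \<le> r i" for i
      using bij_betwE[OF r, rule_format, OF UNIV_I, of i] by simp
    then have "{i. r i \<le> k} = r -` {1..k}"
      by auto
    moreover have "{1..k} \<subseteq> range r"
      using bij_betw_imp_surj_on[OF r] k by auto
    ultimately show ?thesis
      using card_vimage_inj[of r "{1..k}"] bij_betw_imp_inj_on[OF r] by simp
  qed
  ultimately show ?thesis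
    using sym_successive_minimum(2)[OF convex_body_cs[OF A], of k t] k \<open>0 < t\<close>
    by (simp add: successive_min_def)
qed

theorem theorem3p1:
  fixes K :: "(real ^ 'n) set"
  assumes "convex_body K"
  shows "\<exists>A :: (real ^ 'n) set. anti_blocking A \<and>
    measure lebesgue K = measure lebesgue A \<and>
    lattice_count K \<le> lattice_count A \<and>
    lattice_count (interior K) \<ge> lattice_count (interior A) \<and>
    (\<forall>i\<in>{1..CARD('n)}. successive_min i K \<ge> successive_min i A)"
proof -
  obtain e :: "nat \<Rightarrow> 'n" where "bij_betw e {1..CARD('n)} UNIV"
    using ex_bij_betw_nat_finite_1[of "UNIV :: 'n set"] by auto
  then obtain r :: "'n \<Rightarrow> nat" where r: "bij_betw r UNIV {1..CARD('n)}"
    using bij_betw_inv_into by blast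
  have r_bounds: "1 \<le> r i" "r i \<le> CARD('n)" for i
    using bij_betwE[OF r] by auto
  define L where "L = (\<lambda>i. successive_min i K)"
  \<comment> \<open>The dilation attaining the \<open>j\<close>-th minimum has lattice points of
    dimension at least \<open>j\<close>, hence at least \<open>i\<close>, and so bounds the
    \<open>i\<close>-th minimum.\<close>
  have L: "0 < L i" "\<And>j. i \<le> j \<Longrightarrow> j \<le> CARD('n) \<Longrightarrow> L i \<le> L j" if "1 \<le> i" "i \<le> CARD('n)" for i
  proof -
    show "0 < L i"
      using sym_successive_minimum(1)[OF convex_body_cs[OF assms] that] by (simp add: L_def successive_min_def)
    fix j assume "i \<le> j" "j \<le> CARD('n)"
    with that show "L i \<le> L j"
      using sym_successive_minimum(1)[OF convex_body_cs[OF assms], of j]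
        sym_successive_minimum(2)[OF convex_body_cs[OF assms] that, of "L j"]
      by (simp add: L_def successive_min_def)
  qed
  obtain g w where g: "unimodular_map g"
    and w: "\<And>i. w i \<in> cs (g ` K)" "\<And>i. L (r i) *\<^sub>R w i \<in> int_lattice" "\<And>i. w i $ i \<noteq> 0"
      "\<And>i l. r i < r l \<Longrightarrow> w i $ l = 0"
    using lattice_flag[OF assms r order_refl] r_bounds unfolding L_def by blast
  have gK: "convex_body (g ` K)" "compact K"
    using convex_body_unimodular_image[OF g assms] assms by (simp_all add: convex_body_def)
  obtain A where A: "convex_body A" "measure lebesgue A = measure lebesgue (g ` K)"
      "lattice_count (g ` K) \<le> lattice_count A"
      "lattice_count (interior A) \<le> lattice_count (interior (g ` K))"
    and down: "\<And>i. downward_closed_along i A"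
    and wA: "\<And>i. (\<chi> l. if l \<noteq> i then 0 else w i $ l) \<in> cs A"
    using iterated_shake[OF gK(1) r order_refl, of w] w(1,4) r_bounds by auto
  have "successive_min k A \<le> L k" if k: "k \<in> {1..CARD('n)}" for k
  proof (rule successive_min_le_if_axes[OF A(1) r k])
    show "0 < L k" using L k by simp
    fix i assume i: "r i \<le> k"
    have "0 \<in> cs A"
    proof -
      obtain a where "a \<in> A"
        using A(1) interior_subset by (fastforce simp: convex_body_def)
      then show ?thesis by (force simp: cs_def)
    qed
    have "convex (cs A)"
      using convex_body_cs(1)[OF A(1)] by (simp add: convex_body_def)
    \<comment> \<open>The multiple sought is \<open>L (r i) * w i $ i\<close>, an entry of a lattice
      vector. Since the minima increase, \<open>q\<close> is at most 1, and the segment from 0 to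
      the axis vector places this multiple in the larger dilate by \<open>L k\<close>.\<close>
    define q where "q = L (r i) / L k"
    have "0 < L (r i)" "L (r i) \<le> L k"
      using L i k r_bounds by auto
    then have q: "0 \<le> q" "q \<le> 1"
      using \<open>0 < L k\<close> by (auto simp: q_def)
    have "(\<chi> l. if l \<noteq> i then 0 else w i $ l) = w i $ i *\<^sub>R axis i 1"
      by (auto simp: vec_eq_iff axis_def)
    then have "q *\<^sub>R (w i $ i *\<^sub>R axis i 1) + (1 - q) *\<^sub>R 0 \<in> cs A"
      using wA[of i] \<open>0 \<in> cs A\<close> \<open>convex (cs A)\<close> q by (intro convexD) auto
    moreover have "(L (r i) * w i $ i) *\<^sub>R axis i 1 = L k *\<^sub>R (q *\<^sub>R (w i $ i *\<^sub>R axis i 1) + (1 - q) *\<^sub>R 0)"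
      using \<open>0 < L k\<close> by (simp add: q_def)
    ultimately have "(L (r i) * w i $ i) *\<^sub>R axis i 1 \<in> (*\<^sub>R) (L k) ` cs A"
      by blast
    moreover have "(L (r i) * w i $ i) *\<^sub>R axis i 1 \<in> int_lattice"
      using w(2)[of i] by (auto simp: int_lattice_def axis_def)
    moreover have "L (r i) * w i $ i \<noteq> 0"
      using w(3) \<open>0 < L (r i)\<close> by simp
    ultimately show "\<exists>m. m \<noteq> 0 \<and> m *\<^sub>R axis i 1 \<in> (*\<^sub>R) (L k) ` cs A \<inter> int_lattice"
      by blast
  qed
  then show ?thesis
    using A anti_blocking_if_downward_closed_along[OF A(1) down] g gK(2)
    by (intro exI[of _ A]) (simp add: L_def measure_unimodular_image lattice_count_unimodular_image
        interior_unimodular_image)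
qed

end
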